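(* Let $\mathcal{K}$ and $\mathcal{V}$ satisfy (A0), (A1), (A2) as given in the context, let $V_1,\ldots,V_k$ be $b$-subsemimodules of $\mathcal{V}$, and write $P_i=P_{V_i}$. Suppose that the operator $P_k\cdots P_1$ has an archimedean eigenvector $y$ with nonzero eigenvalue $\lambda\in\mathcal{K}$ (that is, $P_k\cdots P_1y=\lambda y$). Then the following are equivalent: 1. there exist an archimedean vector $x\in\mathcal{V}$ and a scalar $\mu\in\mathcal{K}$, $\mu<\mathbf{1}$, such that $P_k\cdots P_1x\le\mu x$; 2. for all $i=1,\ldots,k$ there exist archimedean halfspaces $H_i$ such that $V_i\subseteq H_i$ and $H_1\cap\cdots\cap H_k=\{\mathbf{0}\}$; 3. $V_1\cap\cdots\cap V_k=\{\mathbf{0}\}$; 4. $\lambda<\mathbf{1}$.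
   Context: Setting. A semiring $\mathcal{K}$ (zero $\mathbf{0}$, unit $\mathbf{1}\neq\mathbf{0}$) is idempotent if $a\oplus a=a$ for all $a$. On $\mathcal{K}$ and on a semimodule $\mathcal{V}$ over $\mathcal{K}$ (whose zero is also denoted $\mathbf{0}$), the canonical partial order is $a\le b\Leftrightarrow a\oplus b=b$, so $\oplus$ is the binary supremum; $a<b$ means $a\le b$ and $a\ne b$. A semiring or semimodule is $b$-complete if every subset bounded from above has a supremum and multiplication distributes over such suprema (for a semimodule: scalar multiplication distributes over suprema of bounded sets of vectors and over suprema of bounded sets of scalars). An idempotent semifield is an idempotent semiring $\mathcal{K}$ in which $\mathcal{K}\setminus\{\mathbf{0}\}$ is an abelian group under multiplication. (A0): $\mathcal{K}$ is a $b$-complete idempotent semifield and $\mathcal{V}$ is a $b$-complete semimodule over $\mathcal{K}$. (A1): for all $x\in\mathcal{V}$ and $y\in\mathcal{V}\setminus\{\mathbf{0}\}$, the set $\{\lambda\in\mathcal{K}\mid\lambda y\le x\}$ is bounded from above. Under (A0) and (A1), for $x\in\mathcal{V}$ and $y\in\mathcal{V}\setminus\{\mathbf{0}\}$ put $x/y=\max\{\lambda\in\mathcal{K}\mid \lambda y\le x\}$ (the maximum exists). For $x\neq\mathbf{0}$, write $x\preceq y$ if $y/x\neq\mathbf{0}$; by convention $\mathbf{0}\preceq y$ for all $y$. A vector $x\in\mathcal{V}$ is archimedean if $y\preceq x$ for all $y\in\mathcal{V}$. (A2): $\mathcal{V}$ has an archimedean vector. A $b$-subsemimodule $V$ of $\mathcal{V}$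 is a subsemimodule closed under suprema of its subsets that are bounded from above in $\mathcal{V}$. The projector onto it is $P_V(x)=\max\{u\in V\mid u\le x\}$, $x\in\mathcal{V}$. An eigenvector of an operator $F:\mathcal{V}\to\mathcal{V}$ with eigenvalue $\lambda$ is a nonzero $y$ with $Fy=\lambda y$. A halfspace is a set $H=\{x\in\mathcal{V}\setminus\{\mathbf{0}\}\mid u/x\ge v/x\}\cup\{\mathbf{0}\}$ with $u,v\in\mathcal{V}$, $u\le v$; it is an archimedean halfspace if it is so defined with both $u$ and $v$ archimedean. *)

theory Defs
  imports "HOL-Library.Lub_Glb"
begin

class idempotent_comm_monoid_add = comm_monoid_add + ord +
  assumes add_idem: "a + a = a"
    and le_iff_add_eq: "a \<le> b \<longleftrightarrow> a + b = b"
    and less_iff_le_neq: "a < b \<longleftrightarrow> a \<le> b \<and> a \<noteq> b"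
begin

subclass order
proof
  fix a b c :: 'a
  show "a \<le> a"
    by (simp add: le_iff_add_eq add_idem)
  show "a \<le> c" if "a \<le> b" "b \<le> c"
    using that unfolding le_iff_add_eq by (metis add_assoc)
  show antisym: "a = b" if "a \<le> b" "b \<le> a" for a b
    using that unfolding le_iff_add_eq by (metis add_commute)
  show "a < b \<longleftrightarrow> a \<le> b \<and> \<not> b \<le> a"
    using antisym[of a b] add_idem unfolding less_iff_le_neq le_iff_add_eq by metis
qed

end

text \<open>
  Closure of the nonzero elements under multiplication and nonzeroness of inverses follow from
  the axioms below, so the nonzero elements form an abelian group.
\<close>

class idempotent_semifield = comm_semiring_1 + idempotent_comm_monoid_add +
  assumes ex_mult_inverse: "a \<noteq> 0 \<Longrightarrow> \<exists>b. a * b = 1"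

text \<open>
  The carrier of a semimodule is assumed to be idempotent only in order to have its canonical
  order available as \<open>\<le>\<close>: idempotency is implied by \<open>x + x = (1 + 1) x = x\<close>.
\<close>

locale semimodule =
  fixes scale :: "'k::idempotent_semifield \<Rightarrow> 'v::idempotent_comm_monoid_add \<Rightarrow> 'v"
  assumes scale_add_right: "scale a (x + y) = scale a x + scale a y"
    and scale_add_left: "scale (a + b) x = scale a x + scale b x"
    and scale_scale: "scale a (scale b x) = scale (a * b) x"
    and scale_one: "scale 1 x = x"
    and scale_zero_left: "scale 0 x = 0"
    and scale_zero_right: "scale a 0 = 0"

text \<open>
  A set that has a least upper bound is bounded from above, so the distributivity laws are
  exactly about suprema of bounded sets. The empty set has supremum \<open>0\<close>, so including it
  is harmless.
\<close>

locale b_complete_semimodule = semimodule scale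
  for scale :: "'k::idempotent_semifield \<Rightarrow> 'v::idempotent_comm_monoid_add \<Rightarrow> 'v" +
  assumes ex_lub_scalars: "bdd_above A \<Longrightarrow> \<exists>s. isLub UNIV (A :: 'k set) s"
    and mult_lub: "isLub UNIV (A :: 'k set) s \<Longrightarrow> isLub UNIV ((*) a ` A) (a * s)"
    and ex_lub_vectors: "bdd_above X \<Longrightarrow> \<exists>z. isLub UNIV (X :: 'v set) z"
    and scale_lub_vectors: "isLub UNIV (X :: 'v set) z \<Longrightarrow> isLub UNIV (scale a ` X) (scale a z)"
    and scale_lub_scalars: "isLub UNIV (A :: 'k set) s \<Longrightarrow> isLub UNIV ((\<lambda>a. scale a x) ` A) (scale s x)"

text \<open>The quotient \<open>x/y\<close>; it is only meaningful for \<open>y \<noteq> 0\<close>.\<close>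

definition vquot :: "('k::order \<Rightarrow> 'v::order \<Rightarrow> 'v) \<Rightarrow> 'v \<Rightarrow> 'v \<Rightarrow> 'k" where
  "vquot scale x y = (GREATEST l. scale l y \<le> x)"

definition preceq :: "('k::{zero,order} \<Rightarrow> 'v::{zero,order} \<Rightarrow> 'v) \<Rightarrow> 'v \<Rightarrow> 'v \<Rightarrow> bool" where
  "preceq scale x y \<longleftrightarrow> x = 0 \<or> vquot scale y x \<noteq> 0"

definition archimedean :: "('k::{zero,order} \<Rightarrow> 'v::{zero,order} \<Rightarrow> 'v) \<Rightarrow> 'v \<Rightarrow> bool" where
  "archimedean scale x \<longleftrightarrow> (\<forall>y. preceq scale y x)"

definition b_subsemimodule ::
    "('k \<Rightarrow> 'v::idempotent_comm_monoid_add \<Rightarrow> 'v) \<Rightarrow> 'v set \<Rightarrow> bool" where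
  "b_subsemimodule scale V \<longleftrightarrow>
     0 \<in> V \<and> (\<forall>x\<in>V. \<forall>y\<in>V. x + y \<in> V) \<and> (\<forall>a. \<forall>x\<in>V. scale a x \<in> V) \<and>
     (\<forall>X s. X \<subseteq> V \<and> bdd_above X \<and> isLub UNIV X s \<longrightarrow> s \<in> V)"

definition projector :: "'v::order set \<Rightarrow> 'v \<Rightarrow> 'v" where
  "projector V x = (GREATEST u. u \<in> V \<and> u \<le> x)"

text \<open>The operator \<open>P\<^sub>n \<cdots> P\<^sub>1\<close>, with the projector onto \<open>V 1\<close> applied first.\<close>

primrec cyclic_projector :: "(nat \<Rightarrow> 'v::order set) \<Rightarrow> nat \<Rightarrow> 'v \<Rightarrow> 'v" where
  "cyclic_projector V 0 = id"
| "cyclic_projector V (Suc n) = projector (V (Suc n)) \<circ> cyclic_projector V n"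

definition eigenvector :: "('k \<Rightarrow> 'v::zero \<Rightarrow> 'v) \<Rightarrow> ('v \<Rightarrow> 'v) \<Rightarrow> 'k \<Rightarrow> 'v \<Rightarrow> bool" where
  "eigenvector scale F l y \<longleftrightarrow> y \<noteq> 0 \<and> F y = scale l y"

definition halfspace :: "('k::order \<Rightarrow> 'v::{zero,order} \<Rightarrow> 'v) \<Rightarrow> 'v \<Rightarrow> 'v \<Rightarrow> 'v set" where
  "halfspace scale u v = {x. x \<noteq> 0 \<and> vquot scale u x \<ge> vquot scale v x} \<union> {0}"

definition archimedean_halfspace :: "('k::{zero,order} \<Rightarrow> 'v::{zero,order} \<Rightarrow> 'v) \<Rightarrow> 'v set \<Rightarrow> bool" where
  "archimedean_halfspace scale H \<longleftrightarrow>
     (\<exists>u v. u \<le> v \<and> archimedean scale u \<and> archimedean scale v \<and> H = halfspace scale u v)"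

end

theory Submission
  imports Defs
begin

text \<open>
  The argument is a Collatz--Wielandt comparison: if \<open>c = x/z\<close> is nonzero and
  \<open>c l z \<le> m x\<close>, then maximality of \<open>c\<close> forces \<open>l \<le> m\<close>.
  Applied to \<open>F = P\<^sub>k \<cdots> P\<^sub>1\<close>, this compares the eigenvalue of \<open>y\<close> with \<open>\<mu>\<close> in (1), and with
  \<open>1\<close> when there is a nonzero common point. Conversely \<open>l = 1\<close> forces \<open>y\<close> to be fixed by
  every projector. The separating halfspaces are read off the orbit \<open>y\<^sub>i = P\<^sub>i \<cdots> P\<^sub>1 y\<close>:
  the halfspace of \<open>(y\<^sub>i, y\<^sub>i\<^sub>-\<^sub>1)\<close> contains \<open>V\<^sub>i\<close>, and a nonzero \<open>x\<close> in all of them would satisfy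
  \<open>y/x \<le> (l y)/x\<close>, hence \<open>1 \<le> l\<close> by the comparison.
\<close>

section \<open>Canonical order and idempotent semifields\<close>

lemma canonical_zero_le: "0 \<le> (x :: 'a::idempotent_comm_monoid_add)"
  by (simp add: le_iff_add_eq)

lemma isLub_UNIV_iff: "isLub UNIV A s \<longleftrightarrow> (\<forall>a\<in>A. a \<le> s) \<and> (\<forall>b. (\<forall>a\<in>A. a \<le> b) \<longrightarrow> s \<le> b)"
  by (auto simp: isLub_def leastP_def isUb_def setle_def setge_def)

lemma idempotent_semifield_mult_left_mono:
  fixes a b c :: "'a::idempotent_semifield"
  assumes "a \<le> b"
  shows "c * a \<le> c * b"
  using assms by (metis le_iff_add_eq distrib_left)

lemma idempotent_semifield_mult_eq_0_iff:
  fixes a b :: "'a::idempotent_semifield"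
  shows "a * b = 0 \<longleftrightarrow> a = 0 \<or> b = 0"
proof
  assume ab: "a * b = 0"
  show "a = 0 \<or> b = 0"
  proof (cases "a = 0")
    case False
    then obtain c where "a * c = 1" using ex_mult_inverse by blast
    then have "b = c * (a * b)" by (metis mult.assoc mult.commute mult_1)
    then show ?thesis using ab by simp
  qed simp
qed auto

context semimodule
begin

lemma scale_mono: "x \<le> y \<Longrightarrow> scale a x \<le> scale a y"
  by (metis le_iff_add_eq scale_add_right)

text \<open>A nonzero \<open>a\<close> is invertible, and its inverse recovers \<open>x\<close> from
  \<open>scale a x\<close>.\<close>

lemma scale_eq_0_iff: "scale a x = 0 \<longleftrightarrow> a = 0 \<or> x = 0"
  by (metis ex_mult_inverse mult.commute scale_one scale_scale scale_zero_left scale_zero_right)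

end

section \<open>Projectors and their compositions\<close>

context b_complete_semimodule
begin

text \<open>The supremum of the elements of \<open>V\<close> below \<open>x\<close> belongs to
  \<open>V\<close>, which is closed under bounded suprema; it is therefore the maximum that
  \<open>projector\<close> names.\<close>

lemma
  assumes "b_subsemimodule scale V"
  shows projector_in: "projector V x \<in> V"
    and projector_le: "projector V x \<le> x"
    and projector_greatest: "u \<in> V \<Longrightarrow> u \<le> x \<Longrightarrow> u \<le> projector V x"
proof -
  let ?X = "{u. u \<in> V \<and> u \<le> x}"
  have bdd: "bdd_above ?X" by auto
  then obtain z where z: "isLub UNIV ?X z" using ex_lub_vectors by blast
  have zV: "z \<in> V"
    using assms z bdd unfolding b_subsemimodule_def by (metis (lifting) mem_Collect_eq subsetI)
  have zx: "z \<le> x" and ub: "\<And>u. u \<in> V \<Longrightarrow> u \<le> x \<Longrightarrow> u \<le> z"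
    using z by (auto simp: isLub_UNIV_iff)
  have eq: "projector V x = z"
    unfolding projector_def by (rule Greatest_equality) (use zV zx ub in auto)
  show "projector V x \<in> V" "projector V x \<le> x"
    "u \<in> V \<Longrightarrow> u \<le> x \<Longrightarrow> u \<le> projector V x"
    using eq zV zx ub by auto
qed

lemma projector_mono: "b_subsemimodule scale V \<Longrightarrow> x \<le> x' \<Longrightarrow> projector V x \<le> projector V x'"
  by (meson order_trans projector_greatest projector_in projector_le)

lemma projector_fixed: "b_subsemimodule scale V \<Longrightarrow> x \<in> V \<Longrightarrow> projector V x = x"
  by (simp add: order_antisym projector_greatest projector_le)

text \<open>The scaled projection still lies in \<open>V\<close> and below
  \<open>scale a x\<close>.\<close>

lemma scale_projector_le:
  assumes "b_subsemimodule scale V"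
  shows "scale a (projector V x) \<le> projector V (scale a x)"
  using assms projector_in[OF assms, of x] projector_le[OF assms, of x]
  by (intro projector_greatest) (auto simp: b_subsemimodule_def scale_mono)

lemma cyclic_projector_mono:
  "\<forall>i\<in>{1..n}. b_subsemimodule scale (V i) \<Longrightarrow> x \<le> x' \<Longrightarrow>
    cyclic_projector V n x \<le> cyclic_projector V n x'"
  by (induction n) (auto intro: projector_mono)

lemma cyclic_projector_fixed:
  "\<forall>i\<in>{1..n}. b_subsemimodule scale (V i) \<Longrightarrow> (\<And>i. i \<in> {1..n} \<Longrightarrow> x \<in> V i) \<Longrightarrow>
    cyclic_projector V n x = x"
  by (induction n) (auto intro: projector_fixed)

lemma scale_cyclic_projector_le:
  "\<forall>i\<in>{1..n}. b_subsemimodule scale (V i) \<Longrightarrow>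
    scale a (cyclic_projector V n x) \<le> cyclic_projector V n (scale a x)"
proof (induction n)
  case (Suc n)
  have V: "b_subsemimodule scale (V (Suc n))" using Suc.prems by simp
  have "scale a (cyclic_projector V n x) \<le> cyclic_projector V n (scale a x)"
    using Suc by simp
  then show ?case
    using order_trans[OF scale_projector_le[OF V] projector_mono[OF V]] by simp
qed simp

text \<open>Each projector sends a vector to one below it, so the orbit of \<open>x\<close>
  decreases.\<close>

lemma cyclic_projector_antimono:
  assumes V: "\<forall>i\<in>{1..n}. b_subsemimodule scale (V i)" and "j \<le> n"
  shows "cyclic_projector V n x \<le> cyclic_projector V j x"
  using \<open>j \<le> n\<close> V
proof (induction n rule: dec_induct)
  case (step m)
  then have "cyclic_projector V m x \<le> cyclic_projector V j x" by simp
  moreover have "projector (V (Suc m)) (cyclic_projector V m x) \<le> cyclic_projector V m x"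
    using step.prems by (intro projector_le) simp
  ultimately show ?case by simp
qed simp

end

section \<open>Quotients and archimedean vectors\<close>

locale b_complete_semimodule_A1 = b_complete_semimodule scale
  for scale :: "'k::idempotent_semifield \<Rightarrow> 'v::idempotent_comm_monoid_add \<Rightarrow> 'v" +
  assumes bdd_above_quotients: "y \<noteq> 0 \<Longrightarrow> bdd_above {a. scale a y \<le> x}"
begin

lemma
  assumes "y \<noteq> 0"
  shows scale_vquot_le: "scale (vquot scale x y) y \<le> x"
    and vquot_greatest: "scale a y \<le> x \<Longrightarrow> a \<le> vquot scale x y"
proof -
  let ?A = "{a. scale a y \<le> x}"
  obtain s where s: "isLub UNIV ?A s"
    using ex_lub_scalars[OF bdd_above_quotients[OF assms]] by blast
  \<comment> \<open>The supremum of the admissible scalars is itself admissible, because scaling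
    \<open>y\<close> distributes over suprema of scalars.\<close>
  have sx: "scale s y \<le> x"
    using scale_lub_scalars[OF s, of y] by (auto simp: isLub_UNIV_iff)
  have ub: "\<And>a. scale a y \<le> x \<Longrightarrow> a \<le> s" using s by (auto simp: isLub_UNIV_iff)
  have eq: "vquot scale x y = s"
    unfolding vquot_def by (rule Greatest_equality) (use sx ub in auto)
  show "scale (vquot scale x y) y \<le> x" "scale a y \<le> x \<Longrightarrow> a \<le> vquot scale x y"
    using eq sx ub by auto
qed

lemma archimedean_vquot_neq_0: "archimedean scale x \<Longrightarrow> z \<noteq> 0 \<Longrightarrow> vquot scale x z \<noteq> 0"
  by (auto simp: archimedean_def preceq_def)

text \<open>The product of \<open>a\<close> with the quotient of \<open>x\<close> by
  \<open>z\<close> is a nonzero scalar bounding the quotient of \<open>x'\<close> by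
  \<open>z\<close> from below. This is used to show that the whole orbit of \<open>y\<close> is
  archimedean.\<close>

lemma archimedean_if_scale_le:
  assumes x: "archimedean scale x" and "a \<noteq> 0" and le: "scale a x \<le> x'"
  shows "archimedean scale x'"
  unfolding archimedean_def preceq_def
proof (intro allI disjCI)
  fix z :: 'v
  assume eq: "\<not> vquot scale x' z \<noteq> 0"
  show "z = 0"
  proof (rule ccontr)
    assume z: "z \<noteq> 0"
    let ?c = "vquot scale x z"
    have "scale (a * ?c) z \<le> x'"
      using order_trans[OF scale_mono[OF scale_vquot_le[OF z]] le] by (simp add: scale_scale)
    then have "a * ?c \<le> vquot scale x' z" using z by (rule vquot_greatest[rotated])
    moreover have "a * ?c \<noteq> 0"
      using \<open>a \<noteq> 0\<close> archimedean_vquot_neq_0[OF x z] by (simp add: idempotent_semifield_mult_eq_0_iff)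
    ultimately show False
      using eq by (metis order_antisym canonical_zero_le)
  qed
qed

text \<open>Every bound on the eigenvalue rests on this comparison. Dividing by \<open>b\<close>
  gives a multiple of \<open>z\<close> below \<open>x\<close>, so with c the quotient, c a / b is at
  most c by maximality, and c cancels.\<close>

lemma le_if_scale_vquot_le:
  assumes x: "archimedean scale x" and z: "z \<noteq> 0"
    and le: "scale (vquot scale x z * a) z \<le> scale b x"
  shows "a \<le> b"
proof (cases "b = 0")
  case True
  \<comment> \<open>Division by \<open>b\<close> is impossible here, but the right-hand side
    vanishes; since the quotient and \<open>z\<close> are nonzero, \<open>a\<close> must be
    0.\<close>
  then have "scale (vquot scale x z * a) z = 0"
    using le by (metis order_antisym canonical_zero_le scale_zero_left)
  then show ?thesis
    using z archimedean_vquot_neq_0[OF x z]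
    by (simp add: scale_eq_0_iff idempotent_semifield_mult_eq_0_iff canonical_zero_le)
next
  case False
  let ?c = "vquot scale x z"
  obtain b' where b': "b * b' = 1" using ex_mult_inverse[OF False] by blast
  obtain c' where c': "?c * c' = 1" using ex_mult_inverse[OF archimedean_vquot_neq_0[OF x z]] by blast
  have "scale (b' * (?c * a)) z \<le> scale (b' * b) x"
    using scale_mono[OF le, of b'] by (simp add: scale_scale)
  then have "scale (b' * (?c * a)) z \<le> x"
    using b' by (simp add: mult.commute scale_one)
  then have "b' * (?c * a) \<le> ?c" by (rule vquot_greatest[OF z])
  \<comment> \<open>The factor \<open>b * c'\<close> cancels both \<open>b'\<close> and
    \<open>?c\<close>.\<close>
  then have "(b * c') * (b' * (?c * a)) \<le> (b * c') * ?c"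
    by (rule idempotent_semifield_mult_left_mono)
  moreover have "(b * c') * (b' * (?c * a)) = (b * b') * (?c * c') * a" "(b * c') * ?c = b * (?c * c')"
    by (simp_all add: ac_simps)
  ultimately show ?thesis using b' c' by simp
qed

text \<open>For \<open>z\<close> in \<open>V\<close>, a multiple of \<open>z\<close> below
  \<open>x\<close> is an element of \<open>V\<close> below \<open>x\<close>, hence below the
  projection: projecting \<open>x\<close> does not shrink its quotient by \<open>z\<close>.\<close>

lemma subset_halfspace_projector:
  assumes "b_subsemimodule scale V"
  shows "V \<subseteq> halfspace scale (projector V x) x"
proof
  fix z assume z: "z \<in> V"
  have "vquot scale x z \<le> vquot scale (projector V x) z" if "z \<noteq> 0"
    using assms z scale_vquot_le[OF that, of x]
    by (intro vquot_greatest[OF that] projector_greatest) (auto simp: b_subsemimodule_def)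
  then show "z \<in> halfspace scale (projector V x) x" by (auto simp: halfspace_def)
qed

section \<open>Eigenvalue bounds and the orbit of the eigenvector\<close>

lemma eigenvalue_le_if_subeigenvector:
  assumes V: "\<forall>i\<in>{1..k}. b_subsemimodule scale (V i)"
    and y: "y \<noteq> 0" "cyclic_projector V k y = scale l y"
    and x: "archimedean scale x" "cyclic_projector V k x \<le> scale m x"
  shows "l \<le> m"
proof (rule le_if_scale_vquot_le[OF x(1) y(1)])
  let ?c = "vquot scale x y"
  have "scale (?c * l) y = scale ?c (cyclic_projector V k y)" by (simp add: y scale_scale)
  also have "\<dots> \<le> cyclic_projector V k (scale ?c y)" by (rule scale_cyclic_projector_le[OF V])
  also have "\<dots> \<le> cyclic_projector V k x" by (rule cyclic_projector_mono[OF V scale_vquot_le[OF y(1)]])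
  finally show "scale (?c * l) y \<le> scale m x" using x(2) by order
qed

lemma common_point_imp_one_le_eigenvalue:
  assumes V: "\<forall>i\<in>{1..k}. b_subsemimodule scale (V i)"
    and y: "archimedean scale y" "cyclic_projector V k y = scale l y"
    and z: "z \<noteq> 0" "\<And>i. i \<in> {1..k} \<Longrightarrow> z \<in> V i"
  shows "1 \<le> l"
proof (rule le_if_scale_vquot_le[OF y(1) z(1)])
  let ?c = "vquot scale y z"
  \<comment> \<open>The multiple of \<open>z\<close> still lies in every \<open>V i\<close>, so all
    projectors fix it.\<close>
  have "scale ?c z = cyclic_projector V k (scale ?c z)"
    using V z by (intro cyclic_projector_fixed[symmetric]) (auto simp: b_subsemimodule_def)
  also have "\<dots> \<le> scale l y"
    using cyclic_projector_mono[OF V scale_vquot_le[OF z(1), of y]] y(2) by simp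
  finally show "scale (?c * 1) z \<le> scale l y" by simp
qed

text \<open>A decreasing orbit that ends where it starts is constant, so each projector fixes
  \<open>y\<close>.\<close>

lemma cyclic_projector_fixed_imp_in:
  assumes V: "\<forall>i\<in>{1..k}. b_subsemimodule scale (V i)"
    and Fy: "cyclic_projector V k y = y" and i: "i \<in> {1..k}"
  shows "y \<in> V i"
proof -
  have eq: "cyclic_projector V j y = y" if "j \<le> k" for j
  proof (rule order_antisym)
    show "cyclic_projector V j y \<le> y"
      using cyclic_projector_antimono[of j V 0 y] V that by simp
    show "y \<le> cyclic_projector V j y"
      using cyclic_projector_antimono[of k V j y] V that Fy by simp
  qed
  obtain j where j: "i = Suc j" using i by (cases i) auto
  then have "projector (V i) y = y" using eq[of i] eq[of j] i by simp
  then show ?thesis using projector_in[OF bspec[OF V i], of y] by simp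
qed

lemma orbit_halfspaces_trivial:
  assumes y: "archimedean scale y" "cyclic_projector V k y = scale l y" and z: "z \<noteq> 0"
    and H: "\<And>i. i \<in> {1..k} \<Longrightarrow>
      z \<in> halfspace scale (cyclic_projector V i y) (cyclic_projector V (i - 1) y)"
  shows "1 \<le> l"
proof (rule le_if_scale_vquot_le[OF y(1) z])
  \<comment> \<open>The halfspace conditions chain along the orbit, from index 0, which is
    \<open>y\<close>, up to \<open>k\<close>, which is \<open>scale l y\<close>.\<close>
  have "vquot scale y z \<le> vquot scale (cyclic_projector V n y) z" if "n \<le> k" for n
    using that
  proof (induction n)
    case (Suc n)
    then show ?case using H[of "Suc n"] z by (auto simp: halfspace_def intro: order_trans)
  qed simp
  from this[of k] have "vquot scale y z \<le> vquot scale (scale l y) z" using y by simp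
  then have "scale (vquot scale y z) z \<le> scale (vquot scale (scale l y) z) z"
    by (metis le_iff_add_eq scale_add_left)
  also have "\<dots> \<le> scale l y" by (rule scale_vquot_le[OF z])
  finally show "scale (vquot scale y z * 1) z \<le> scale l y" by simp
qed

end

text \<open>Condition 4 is the hub: each of the other three conditions is compared with
  \<open>l < 1\<close>.\<close>

theorem theorem16:
  fixes scale :: "'k::idempotent_semifield \<Rightarrow> 'v::idempotent_comm_monoid_add \<Rightarrow> 'v"
    and V :: "nat \<Rightarrow> 'v set" and k :: nat and y :: 'v and l :: 'k
  assumes A0: "b_complete_semimodule scale"
    and A1: "\<And>x y. y \<noteq> 0 \<Longrightarrow> bdd_above {a. scale a y \<le> x}"
    and A2: "\<exists>x. archimedean scale x"
    and k: "k \<ge> 1"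
    and V: "\<And>i. i \<in> {1..k} \<Longrightarrow> b_subsemimodule scale (V i)"
    and y: "archimedean scale y" "eigenvector scale (cyclic_projector V k) l y"
    and l: "l \<noteq> 0"
  shows
    "((\<exists>x m. archimedean scale x \<and> m < 1 \<and> cyclic_projector V k x \<le> scale m x) \<longleftrightarrow> l < 1) \<and>
     ((\<exists>H. (\<forall>i\<in>{1..k}. archimedean_halfspace scale (H i) \<and> V i \<subseteq> H i) \<and>
           (\<Inter>i\<in>{1..k}. H i) = {0}) \<longleftrightarrow> l < 1) \<and>
     ((\<Inter>i\<in>{1..k}. V i) = {0} \<longleftrightarrow> l < 1)"
proof -
  have V: "\<forall>i\<in>{1..k}. b_subsemimodule scale (V i)" using V by blast
  interpret b_complete_semimodule_A1 scale
    using A0 A1 by (simp add: b_complete_semimodule_A1_def b_complete_semimodule_A1_axioms_def)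
  let ?F = "cyclic_projector V"
  have y0: "y \<noteq> 0" and Fy: "?F k y = scale l y" using y(2) by (simp_all add: eigenvector_def)
  have zero_in: "0 \<in> V i" if "i \<in> {1..k}" for i using bspec[OF V that] by (simp add: b_subsemimodule_def)
  \<comment> \<open>Orbits decrease, so \<open>y\<close> itself is a subeigenvector for the scalar
    1.\<close>
  have l_le: "l \<le> 1"
    using eigenvalue_le_if_subeigenvector[OF V y0 Fy y(1), of 1]
      cyclic_projector_antimono[OF V, of 0 y] by (simp add: scale_one)
  have 1: "(\<exists>x m. archimedean scale x \<and> m < 1 \<and> ?F k x \<le> scale m x) \<longleftrightarrow> l < 1"
  proof
    assume "\<exists>x m. archimedean scale x \<and> m < 1 \<and> ?F k x \<le> scale m x"
    then obtain x m where "archimedean scale x" "m < 1" "?F k x \<le> scale m x" by blast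
    then show "l < 1"
      using eigenvalue_le_if_subeigenvector[OF V y0 Fy, of x m] by (blast intro: order_le_less_trans)
  next
    assume "l < 1"
    then show "\<exists>x m. archimedean scale x \<and> m < 1 \<and> ?F k x \<le> scale m x"
      using y(1) Fy by (intro exI[of _ y] exI[of _ l]) simp
  qed
  have 3: "(\<Inter>i\<in>{1..k}. V i) = {0} \<longleftrightarrow> l < 1"
  proof
    assume trivial: "(\<Inter>i\<in>{1..k}. V i) = {0}"
    \<comment> \<open>The order may be partial, so strictness is obtained from \<open>l_le\<close>
      by excluding equality.\<close>
    have "l \<noteq> 1"
    proof
      assume "l = 1"
      then have "?F k y = y" using Fy by (simp add: scale_one)
      then have "y \<in> (\<Inter>i\<in>{1..k}. V i)" using cyclic_projector_fixed_imp_in[OF V] by blast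
      then show False using trivial y0 by blast
    qed
    then show "l < 1" using l_le by simp
  next
    assume "l < 1"
    then have "z = 0" if "\<And>i. i \<in> {1..k} \<Longrightarrow> z \<in> V i" for z
      using common_point_imp_one_le_eigenvalue[OF V y(1) Fy _ that] by fastforce
    then show "(\<Inter>i\<in>{1..k}. V i) = {0}" using zero_in by auto
  qed
  have 2: "(\<exists>H. (\<forall>i\<in>{1..k}. archimedean_halfspace scale (H i) \<and> V i \<subseteq> H i) \<and>
           (\<Inter>i\<in>{1..k}. H i) = {0}) \<longleftrightarrow> l < 1"
  proof
    assume "\<exists>H. (\<forall>i\<in>{1..k}. archimedean_halfspace scale (H i) \<and> V i \<subseteq> H i) \<and>
           (\<Inter>i\<in>{1..k}. H i) = {0}"
    \<comment> \<open>The intersection of the \<open>V i\<close> is contained in that of the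
      \<open>H i\<close>, which reduces this direction to \<open>3\<close>.\<close>
    then have "(\<Inter>i\<in>{1..k}. V i) \<subseteq> {0}" by blast
    then have "(\<Inter>i\<in>{1..k}. V i) = {0}" using zero_in by auto
    then show "l < 1" using 3 by simp
  next
    assume "l < 1"
    define H where "H i = halfspace scale (?F i y) (?F (i - 1) y)" for i
    \<comment> \<open>The end of the orbit, \<open>scale l y\<close>, lies below each of its
      members, and \<open>l\<close> is nonzero.\<close>
    have arch: "archimedean scale (?F i y)" if "i \<le> k" for i
      using archimedean_if_scale_le[OF y(1) l] cyclic_projector_antimono[OF V that, of y] Fy by simp
    have "archimedean_halfspace scale (H i) \<and> V i \<subseteq> H i" if i: "i \<in> {1..k}" for i
    proof
      have eq: "?F i y = projector (V i) (?F (i - 1) y)" using i by (cases i) auto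
      have "?F i y \<le> ?F (i - 1) y" unfolding eq by (rule projector_le[OF bspec[OF V i]])
      then show "archimedean_halfspace scale (H i)"
        unfolding archimedean_halfspace_def H_def
        using i arch[of i] arch[of "i - 1"]
        by (intro exI[of _ "?F i y"] exI[of _ "?F (i - 1) y"]) auto
      show "V i \<subseteq> H i"
        unfolding H_def eq by (rule subset_halfspace_projector[OF bspec[OF V i]])
    qed
    moreover have "(\<Inter>i\<in>{1..k}. H i) = {0}"
    proof -
      have "z = 0" if "\<And>i. i \<in> {1..k} \<Longrightarrow> z \<in> H i" for z
        using orbit_halfspaces_trivial[OF y(1) Fy, of z] that \<open>l < 1\<close> unfolding H_def by fastforce
      moreover have "0 \<in> H i" for i by (simp add: H_def halfspace_def)
      ultimately show ?thesis by auto
    qed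
    ultimately show "\<exists>H. (\<forall>i\<in>{1..k}. archimedean_halfspace scale (H i) \<and> V i \<subseteq> H i) \<and>
           (\<Inter>i\<in>{1..k}. H i) = {0}" by blast
  qed
  show ?thesis using 1 2 3 by blast
qed

end
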